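(* For every link $L$, $$t_C(L) + \operatorname{connpts}(L) \geq t(L).$$
   Context: Links are nonempty tame links in $S^3$, unoriented and considered up to ambient isotopy. Edge tiles. There are 11 edge tiles $T_0,\dots,T_{10}$, each a unit square carrying curves whose endpoints are midpoints of its sides: $T_0$ is empty; $T_1,T_2,T_3,T_4$ each carry a single arc joining the midpoints of two adjacent sides (respectively left/bottom, bottom/right, right/top, top/left); $T_5$ carries a segment joining the left and right midpoints; $T_6$ carries a segment joining the bottom and top midpoints; $T_7,T_8$ are the two tiles carrying two disjoint arcs, each joining midpoints of adjacent sides; $T_9,T_{10}$ carry the horizontal and the vertical segment crossing once at the center, with the two possible choices of over/under information. Edge mosaics. An edge mosaic is a finite rectangular grid of edge tiles such that every endpoint of a curve on a tile coincides with an endpoint of a curve on the edge-adjacent tile (in particular no endpoints lie on the outer boundary of the grid). It is thus a link diagram, and it represents the corresponding link. The edge tile number $t(L)$ is the minimum number of nonempty tiles (tiles other than $T_0$) in an edge mosaic representing $L$. Corner tiles. The pattern on each corner tile is the pattern on the corresponding edge tile rotated clockwise by $\pi/4$, with the curve endpoints now placed at corners of the square: $T_0$ is empty; $T_1,T_2,T_3,T_4$ carry a single arc joining the two left, the two bottom, the two right, the two top corners, respectively; $T_5$ carries a segment from upper-left to lower-right corner; $T_6$ carries a segment from lower-left to upper-right corner; $T_7,T_8$ are the two tiles carrying two disjoint arcs, each joining two adjacent corners; $T_9,T_{10}$ carry both diagonals crossing once at the center, with the two possible choices of over/under information. Corner mosaics. A corner mosaic is a finite rectangular grid of corner tiles such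 that every vertex of the grid is an endpoint of either no curve or exactly two curves on the tiles meeting at that vertex. It is thus a link diagram and represents the corresponding link. The corner tile number $t_C(L)$ is the minimum number of nonempty tiles in a corner mosaic representing $L$. Connection points. A connection point of a corner mosaic is a point on the boundary of a tile (necessarily a vertex of the grid) that is the endpoint of a curve drawn on the tile; each such point of the plane is counted once. Let $\mathscr M_C^L$ be the set of corner mosaics for $L$ with exactly $t_C(L)$ nonempty tiles. Define $\operatorname{connpts}(L)=\min\{\text{number of connection points in } M \mid M\in\mathscr M_C^L\}$. *)

theory Defs
  imports "HOL-Analysis.Analysis" "HOL-Library.Extended_Nat"
begin

section \<open>Links in the 3-sphere\<close>

type_synonym plane = "real \<times> real"
type_synonym space = "plane \<times> real"

abbreviation S3 :: "(space \<times> real) set"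
  where "S3 \<equiv> sphere 0 1"

text \<open>Inverse stereographic projection from the pole \<open>(0, 1)\<close>; its range is \<open>S3\<close> minus that pole.\<close>

definition to_S3 :: "space \<Rightarrow> space \<times> real"
  where "to_S3 x = ((2 / ((norm x)\<^sup>2 + 1)) *\<^sub>R x, ((norm x)\<^sup>2 - 1) / ((norm x)\<^sup>2 + 1))"

lemma to_S3_in_S3: "to_S3 x \<in> S3"
proof -
  define r where "r = (norm x)\<^sup>2"
  have r: "r + 1 > 0" unfolding r_def by (smt (verit) zero_le_power2)
  have "(norm (to_S3 x))\<^sup>2 = (2 / (r + 1))\<^sup>2 * r + ((r - 1) / (r + 1))\<^sup>2"
    by (simp add: to_S3_def norm_Pair r_def power_mult_distrib power_divide)
  also have "\<dots> = (4 * r + (r - 1)\<^sup>2) / (r + 1)\<^sup>2"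
    by (simp add: power_divide add_divide_distrib)
  also have "4 * r + (r - 1)\<^sup>2 = (r + 1)\<^sup>2"
    by (simp add: power2_eq_square algebra_simps)
  finally have "(norm (to_S3 x))\<^sup>2 = 1" using r by simp
  then show ?thesis by (simp add: power2_eq_1_iff) (smt (verit) norm_ge_zero)
qed

definition ambient_isotopic :: "(space \<times> real) set \<Rightarrow> (space \<times> real) set \<Rightarrow> bool"
  where "ambient_isotopic K L \<longleftrightarrow>
    (\<exists>f. homotopic_with (homeomorphic_map (top_of_set S3) (top_of_set S3))
           (top_of_set S3) (top_of_set S3) id f \<and> f ` K = L)"

definition link :: "'a::topological_space set \<Rightarrow> bool"
  where "link K \<longleftrightarrow>
    (\<exists>C. finite C \<and> C \<noteq> {} \<and> disjoint C \<and> \<Union>C = K \<and>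
       (\<forall>c\<in>C. \<exists>g. simple_path g \<and> pathfinish g = pathstart g \<and> path_image g = c))"

definition polygonal_link :: "space set \<Rightarrow> bool"
  where "polygonal_link K \<longleftrightarrow>
    link K \<and> (\<exists>E. finite E \<and> K = (\<Union>(p, q)\<in>E. closed_segment p q))"

definition tame_link :: "(space \<times> real) set \<Rightarrow> bool"
  where "tame_link L \<longleftrightarrow>
    L \<subseteq> S3 \<and> link L \<and> (\<exists>P. polygonal_link P \<and> ambient_isotopic (to_S3 ` P) L)"


section \<open>Tiles and mosaics\<close>

text \<open>
  The constructors of \<open>side\<close> name the four places where a curve can end on a tile. On an
  edge tile these are the midpoints of the sides; on a corner tile they are the corners
  obtained from those midpoints by the clockwise rotation through \<open>\<pi>/4\<close>, so that
  \<open>Left, Bottom, Right, Top\<close> become the upper-left, lower-left, lower-right and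
  upper-right corner.
\<close>

datatype side = Left | Bottom | Right | Top

datatype tile = T0 | T1 | T2 | T3 | T4 | T5 | T6 | T7 | T8 | T9 | T10

text \<open>
  A strand \<open>(a, b, h)\<close> is a curve from \<open>a\<close> to \<open>b\<close> whose midpoint is lifted to height \<open>h\<close>;
  at a crossing the strand with \<open>h = 1\<close> is the overstrand.
\<close>

type_synonym strand = "side \<times> side \<times> real"

fun strands :: "tile \<Rightarrow> strand set" where
  "strands T0 = {}"
| "strands T1 = {(Left, Bottom, 0)}"
| "strands T2 = {(Bottom, Right, 0)}"
| "strands T3 = {(Right, Top, 0)}"
| "strands T4 = {(Top, Left, 0)}"
| "strands T5 = {(Left, Right, 0)}"
| "strands T6 = {(Bottom, Top, 0)}"
| "strands T7 = {(Left, Bottom, 0), (Right, Top, 0)}"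
| "strands T8 = {(Bottom, Right, 0), (Top, Left, 0)}"
| "strands T9 = {(Left, Right, 1), (Bottom, Top, 0)}"
| "strands T10 = {(Left, Right, 0), (Bottom, Top, 1)}"

definition ends :: "tile \<Rightarrow> side set"
  where "ends t = (\<Union>(a, b, h)\<in>strands t. {a, b})"

text \<open>
  The cell \<open>(i, j)\<close> is the unit square \<open>[i, i + 1] \<times> [j, j + 1]\<close>. Values of \<open>tile_at\<close> outside
  the grid are never used.
\<close>

type_synonym cell = "int \<times> int"

record mosaic =
  width :: nat
  height :: nat
  tile_at :: "cell \<Rightarrow> tile"

definition cells :: "mosaic \<Rightarrow> cell set"
  where "cells M = {0..<int (width M)} \<times> {0..<int (height M)}"

definition grid_vertices :: "mosaic \<Rightarrow> plane set"
  where "grid_vertices M =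
    {(of_int i, of_int j) | i j. i \<in> {0..int (width M)} \<and> j \<in> {0..int (height M)}}"

definition tile_count :: "mosaic \<Rightarrow> nat"
  where "tile_count M = card {c \<in> cells M. tile_at M c \<noteq> T0}"

fun center :: "cell \<Rightarrow> plane"
  where "center (i, j) = (of_int i + 1/2, of_int j + 1/2)"

fun edge_adjacent :: "cell \<Rightarrow> cell \<Rightarrow> bool"
  where "edge_adjacent (i, j) (i', j') \<longleftrightarrow> \<bar>i - i'\<bar> + \<bar>j - j'\<bar> = 1"

fun polyline :: "'a::real_vector list \<Rightarrow> 'a set" where
  "polyline (p # q # ps) = closed_segment p q \<union> polyline (q # ps)"
| "polyline ps = {}"


subsection \<open>Edge mosaics\<close>

fun edge_offset :: "side \<Rightarrow> plane" where
  "edge_offset Left = (-1/2, 0)"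
| "edge_offset Bottom = (0, -1/2)"
| "edge_offset Right = (1/2, 0)"
| "edge_offset Top = (0, 1/2)"

definition edge_endpoint :: "cell \<Rightarrow> side \<Rightarrow> plane"
  where "edge_endpoint c s = center c + edge_offset s"

definition edge_mosaic :: "mosaic \<Rightarrow> bool"
  where "edge_mosaic M \<longleftrightarrow>
    (\<forall>c\<in>cells M. \<forall>s\<in>ends (tile_at M c).
       \<exists>c'\<in>cells M. edge_adjacent c c' \<and>
         (\<exists>s'\<in>ends (tile_at M c'). edge_endpoint c s = edge_endpoint c' s'))"

text \<open>
  For \<open>h = 0\<close> the strand is the straight segment between the two midpoints of sides: for
  opposite sides this runs through the centre of the tile, for adjacent sides it cuts off
  a corner.
\<close>

fun edge_strand :: "cell \<Rightarrow> strand \<Rightarrow> space set" where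
  "edge_strand c (a, b, h) =
    (let p = edge_endpoint c a; q = edge_endpoint c b
     in polyline [(p, 0), (midpoint p q, h), (q, 0)])"

definition edge_link :: "mosaic \<Rightarrow> space set"
  where "edge_link M = (\<Union>c\<in>cells M. \<Union>s\<in>strands (tile_at M c). edge_strand c s)"

definition edge_mosaics :: "(space \<times> real) set \<Rightarrow> mosaic set"
  where "edge_mosaics L = {M. edge_mosaic M \<and> ambient_isotopic (to_S3 ` edge_link M) L}"

text \<open>
  In \<open>enat\<close> the infimum of a nonempty set is its minimum, and the infimum of the empty set
  is \<open>\<infinity>\<close> rather than an arbitrary number.
\<close>

definition edge_tile_number :: "(space \<times> real) set \<Rightarrow> enat"
  where "edge_tile_number L = (INF M\<in>edge_mosaics L. enat (tile_count M))"


subsection \<open>Corner mosaics\<close>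

fun corner_offset :: "side \<Rightarrow> plane" where
  "corner_offset Left = (-1/2, 1/2)"
| "corner_offset Bottom = (-1/2, -1/2)"
| "corner_offset Right = (1/2, -1/2)"
| "corner_offset Top = (1/2, 1/2)"

definition corner_endpoint :: "cell \<Rightarrow> side \<Rightarrow> plane"
  where "corner_endpoint c s = center c + corner_offset s"

text \<open>
  Distinct curves on a tile have distinct endpoints, so the pairs \<open>(c, s)\<close> below correspond
  to the curves that end at \<open>v\<close>.
\<close>

definition corner_mosaic :: "mosaic \<Rightarrow> bool"
  where "corner_mosaic M \<longleftrightarrow>
    (\<forall>v\<in>grid_vertices M.
       card {(c, s). c \<in> cells M \<and> s \<in> ends (tile_at M c) \<and> corner_endpoint c s = v} \<in> {0, 2})"

text \<open>
  The pattern of the edge tile is rotated, shrunk to the square whose vertices are the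
  midpoints of the sides of the tile, and joined to the corners by straight segments. Thus
  an arc between adjacent corners meets the boundary of the tile only in these corners.
\<close>

fun corner_strand :: "cell \<Rightarrow> strand \<Rightarrow> space set" where
  "corner_strand c (a, b, h) =
    (let p = corner_endpoint c a; q = corner_endpoint c b;
         p' = midpoint (center c) p; q' = midpoint (center c) q
     in polyline [(p, 0), (p', 0), (midpoint p' q', h), (q', 0), (q, 0)])"

definition corner_link :: "mosaic \<Rightarrow> space set"
  where "corner_link M = (\<Union>c\<in>cells M. \<Union>s\<in>strands (tile_at M c). corner_strand c s)"

definition corner_mosaics :: "(space \<times> real) set \<Rightarrow> mosaic set"
  where "corner_mosaics L = {M. corner_mosaic M \<and> ambient_isotopic (to_S3 ` corner_link M) L}"

definition corner_tile_number :: "(space \<times> real) set \<Rightarrow> enat"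
  where "corner_tile_number L = (INF M\<in>corner_mosaics L. enat (tile_count M))"

definition connection_points :: "mosaic \<Rightarrow> plane set"
  where "connection_points M = (\<Union>c\<in>cells M. corner_endpoint c ` ends (tile_at M c))"

definition minimal_corner_mosaics :: "(space \<times> real) set \<Rightarrow> mosaic set"
  where "minimal_corner_mosaics L =
    {M \<in> corner_mosaics L. enat (tile_count M) = corner_tile_number L}"

definition connpts :: "(space \<times> real) set \<Rightarrow> enat"
  where "connpts L = (INF M\<in>minimal_corner_mosaics L. enat (card (connection_points M)))"

end

theory Submission
  imports Defs
begin

text \<open>
  Rotate a corner mosaic counterclockwise by \<open>\<pi>/4\<close> and stretch it by \<open>\<surd>2\<close>. The centers and the
  vertices of the old grid then become the centers of the cells of one new unit grid, where
  they alternate like the two colors of a chessboard. In a cell around an old center one sees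
  exactly the edge tile with the number of the old corner tile: a corner strand was defined as
  the rotated and shrunk edge pattern with straight segments to the corners attached, and these
  segments leave the new cell. In a cell around an old vertex one sees nothing, or two segments
  that run from the midpoints of two sides to the center, because exactly two curves end at a
  connection point and they come from different tiles. When the two sides are opposite, this
  is the straight edge tile; when they are adjacent, it is the edge tile with one arc, except
  that the arc has a right angle at the center instead of cutting the corner. The new grid is an
  edge mosaic (\<open>edge_mosaic_unfolded\<close>) with one nonempty tile per nonempty old tile and one
  per connection point (\<open>tile_count_unfolded\<close>). Taking a minimal corner mosaic with the fewest
  connection points gives the inequality.

  The two links are ambient isotopic (\<open>ambient_isotopic_unfolded\<close>). Both the rotation and the
  removal of a right angle are maps \<open>g\<close> of 3-space such that every \<open>(1 - t) x + t g(x)\<close> is a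
  bijection and moves no point far towards the origin, so the straight-line homotopy
  extends to the 3-sphere by fixing the pole (\<open>ambient_isotopic_straight_line\<close>). For the
  rotation, bijectivity is the positive determinant \<open>1 + t\<^sup>2\<close>; for a right angle, \<open>g\<close> is the
  identity plus a contraction supported over a single cell (\<open>straighten_corners\<close>).
\<close>


section \<open>Ambient isotopy\<close>

lemma ambient_isotopic_trans [trans]:
  assumes "ambient_isotopic K L" and "ambient_isotopic L N"
  shows "ambient_isotopic K N"
proof -
  let ?S = "top_of_set S3" let ?P = "homeomorphic_map ?S ?S"
  obtain f where f: "homotopic_with ?P ?S ?S id f" "f ` K = L"
    using assms(1) unfolding ambient_isotopic_def by blast
  obtain g where g: "homotopic_with ?P ?S ?S id g" "g ` L = N"
    using assms(2) unfolding ambient_isotopic_def by blast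
  have Pf: "?P f"
    using homotopic_with_imp_property[OF f(1)] by blast
  have "homotopic_with ?P ?S ?S (id \<circ> f) (g \<circ> f)"
    by (rule homotopic_with_compose_continuous_map_right[OF g(1)])
      (use Pf homeomorphic_imp_continuous_map[OF Pf] in \<open>auto intro: homeomorphic_map_compose\<close>)
  then have "homotopic_with ?P ?S ?S id (g \<circ> f)"
    using homotopic_with_trans[OF f(1)] by simp
  moreover have "(g \<circ> f) ` K = N"
    using f(2) g(2) by (auto simp: image_comp)
  ultimately show ?thesis
    unfolding ambient_isotopic_def by blast
qed

text \<open>
  Composing an isotopy from \<open>id\<close> to \<open>f\<close> with the fixed map \<open>f\<inverse>\<close> on the right gives an isotopy
  from \<open>f\<inverse>\<close> to \<open>id\<close>; in this way one need not show that the inverses depend continuously on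
  the time.
\<close>

lemma ambient_isotopic_sym:
  assumes "ambient_isotopic K L" and "K \<subseteq> S3"
  shows "ambient_isotopic L K"
proof -
  let ?S = "top_of_set S3" let ?P = "homeomorphic_map ?S ?S"
  obtain f where f: "homotopic_with ?P ?S ?S id f" "f ` K = L"
    using assms(1) unfolding ambient_isotopic_def by blast
  have Pf: "?P f"
    using homotopic_with_imp_property[OF f(1)] by blast
  then obtain g where g: "homeomorphic_maps ?S ?S f g"
    using homeomorphic_map_maps by blast
  have Pg: "?P g"
    using g homeomorphic_maps_map by blast
  have fg: "\<And>x. x \<in> S3 \<Longrightarrow> g (f x) = x" "\<And>x. x \<in> S3 \<Longrightarrow> f (g x) = x"
    using g by (auto simp: homeomorphic_maps_def)
  have "homotopic_with ?P ?S ?S (id \<circ> g) (f \<circ> g)"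
    by (rule homotopic_with_compose_continuous_map_right[OF f(1)])
      (use Pg homeomorphic_imp_continuous_map[OF Pg] in \<open>auto intro: homeomorphic_map_compose\<close>)
  then have "homotopic_with ?P ?S ?S g (f \<circ> g)"
    by simp
  moreover have "homotopic_with ?P ?S ?S (f \<circ> g) id"
  proof (rule homotopic_with_equal)
    show P: "?P (f \<circ> g)"
      using Pf Pg homeomorphic_map_compose by blast
    show "continuous_map ?S ?S (f \<circ> g)"
      using P by (rule homeomorphic_imp_continuous_map)
  qed (use fg(2) in auto)
  ultimately have "homotopic_with ?P ?S ?S g id"
    using homotopic_with_trans by blast
  moreover have "g ` L = K"
    using f(2) fg(1) assms(2) by (force simp: image_iff)
  ultimately show ?thesis
    unfolding ambient_isotopic_def using homotopic_with_symD by blast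
qed

abbreviation pole :: "space \<times> real"
  where "pole \<equiv> (0, 1)"

definition from_S3 :: "space \<times> real \<Rightarrow> space"
  where "from_S3 y = (1 / (1 - snd y)) *\<^sub>R fst y"

lemma from_to_S3 [simp]: "from_S3 (to_S3 x) = x"
proof -
  have "(norm x)\<^sup>2 + 1 \<noteq> 0"
    by (smt (verit) zero_le_power2)
  then show ?thesis
    by (simp add: from_S3_def to_S3_def field_simps)
qed

lemma S3_snd_less:
  assumes "y \<in> S3" "y \<noteq> pole"
  shows "snd y < 1"
proof -
  obtain x s where y: "y = (x, s)" by (cases y)
  have n: "(norm x)\<^sup>2 + s\<^sup>2 = 1"
    using assms(1) by (simp add: y norm_Pair)
  have "s \<le> 1"
    using n by (smt (verit) power2_le_imp_le one_power2 zero_le_power2)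
  moreover have "s \<noteq> 1"
    using n assms(2) y by auto
  ultimately show ?thesis by (simp add: y)
qed

lemma to_from_S3:
  assumes "y \<in> S3" "y \<noteq> pole"
  shows "to_S3 (from_S3 y) = y"
proof -
  obtain x s where y: "y = (x, s)" by (cases y)
  have n: "(norm x)\<^sup>2 = 1 - s\<^sup>2"
    using assms(1) by (simp add: y norm_Pair)
  have s: "1 - s > 0"
    using S3_snd_less[OF assms] by (simp add: y)
  have r: "(norm (from_S3 y))\<^sup>2 = (1 + s) / (1 - s)"
  proof -
    have "(norm (from_S3 y))\<^sup>2 = (1 - s\<^sup>2) / (1 - s)\<^sup>2"
      by (simp add: from_S3_def y power_mult_distrib power_divide n)
    also have "1 - s\<^sup>2 = (1 + s) * (1 - s)"
      by (simp add: power2_eq_square algebra_simps)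
    finally show ?thesis
      using s by (simp add: power2_eq_square)
  qed
  have d: "(norm (from_S3 y))\<^sup>2 + 1 = 2 / (1 - s)" "(norm (from_S3 y))\<^sup>2 - 1 = 2 * s / (1 - s)"
    using s by (simp_all add: r field_simps)
  show ?thesis
    unfolding to_S3_def d using s by (simp add: from_S3_def y)
qed

lemma to_S3_neq_pole [simp]: "to_S3 x \<noteq> pole"
proof
  assume "to_S3 x = pole"
  then have "((norm x)\<^sup>2 - 1) / ((norm x)\<^sup>2 + 1) = 1"
    by (simp add: to_S3_def)
  then have "(norm x)\<^sup>2 - 1 = (norm x)\<^sup>2 + 1"
    by (metis divide_eq_1_iff)
  then show False by linarith
qed

lemma dist_to_S3_pole: "(dist (to_S3 x) pole)\<^sup>2 = 4 / ((norm x)\<^sup>2 + 1)"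
proof -
  define r where "r = (norm x)\<^sup>2"
  have r: "r + 1 > 0" unfolding r_def by (smt (verit) zero_le_power2)
  have "(dist (to_S3 x) pole)\<^sup>2 = (2 / (r + 1))\<^sup>2 * r + ((r - 1) / (r + 1) - 1)\<^sup>2"
    by (simp add: to_S3_def dist_norm norm_Pair r_def power_mult_distrib power_divide)
  also have "(r - 1) / (r + 1) - 1 = - 2 / (r + 1)"
    using r by (simp add: field_simps)
  also have "(2 / (r + 1))\<^sup>2 * r + (- 2 / (r + 1))\<^sup>2 = 4 * (r + 1) / (r + 1)\<^sup>2"
    by (simp add: power_divide add_divide_distrib)
  also have "\<dots> = 4 / (r + 1)"
    using r by (simp add: power2_eq_square del: distrib_left_numeral)
  finally show ?thesis by (simp add: r_def)
qed

lemma continuous_on_to_S3: "continuous_on A to_S3"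
proof -
  have "(norm x)\<^sup>2 + 1 \<noteq> 0" for x :: space
    by (smt (verit) zero_le_power2)
  then show ?thesis
    unfolding to_S3_def by (intro continuous_intros) auto
qed

lemma continuous_on_from_S3: "continuous_on (S3 - {pole}) from_S3"
  unfolding from_S3_def using S3_snd_less by (intro continuous_intros) fastforce

text \<open>
  Outside the sphere the extension is the identity, so that extending the identity of 3-space
  gives the identity everywhere: a homotopy has to start at \<open>id\<close> as a total function.
\<close>

definition extend_S3 :: "(space \<Rightarrow> space) \<Rightarrow> space \<times> real \<Rightarrow> space \<times> real"
  where "extend_S3 g y = (if y \<in> S3 - {pole} then to_S3 (g (from_S3 y)) else y)"

lemma extend_S3_in_S3: "y \<in> S3 \<Longrightarrow> extend_S3 g y \<in> S3"
  unfolding extend_S3_def by (simp only: to_S3_in_S3 split: if_split) blast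

lemma extend_S3_to_S3: "extend_S3 g (to_S3 x) = to_S3 (g x)"
  unfolding extend_S3_def using to_S3_in_S3[of x] by simp

text \<open>
  By \<open>dist_to_S3_pole\<close>, the distance from the pole is comparable to \<open>1 / norm x\<close> for large \<open>x\<close>.
  A map that moves no point towards the origin by more than \<open>B\<close> therefore extends to a map that
  is Lipschitz at the pole. The constant depends on \<open>B\<close> only, which yields continuity in time
  and space together.
\<close>

lemma dist_extend_S3_pole:
  assumes growth: "norm (from_S3 y) \<le> norm (g (from_S3 y)) + B" and y: "y \<in> S3" and "B \<ge> 0"
  shows "dist (extend_S3 g y) pole \<le> sqrt (2 + 2 * B\<^sup>2) * dist y pole"
proof (cases "y = pole")
  case False
  define n m where "n = norm (from_S3 y)" and "m = norm (g (from_S3 y))"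
  have n: "0 \<le> n" "0 \<le> m" "n \<le> m + B"
    using growth by (auto simp: n_def m_def)
  have "n\<^sup>2 \<le> (m + B)\<^sup>2"
    using n by (intro power_mono) auto
  also have "\<dots> \<le> 2 * m\<^sup>2 + 2 * B\<^sup>2"
    using zero_le_power2[of "m - B"] by (simp add: power2_eq_square algebra_simps)
  finally have *: "n\<^sup>2 \<le> 2 * m\<^sup>2 + 2 * B\<^sup>2" .
  have le: "n\<^sup>2 + 1 \<le> (2 + 2 * B\<^sup>2) * (m\<^sup>2 + 1)"
  proof -
    have "(2 + 2 * B\<^sup>2) * (m\<^sup>2 + 1) = 2 * m\<^sup>2 + 2 * B\<^sup>2 + 2 + 2 * (B\<^sup>2 * m\<^sup>2)"
      by (simp add: algebra_simps)
    then show ?thesis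
      using * mult_nonneg_nonneg[OF zero_le_power2[of B] zero_le_power2[of m]] by linarith
  qed
  have pos: "n\<^sup>2 + 1 > 0" "m\<^sup>2 + 1 > 0"
    by (smt (verit) zero_le_power2)+
  have "(dist (extend_S3 g y) pole)\<^sup>2 = 4 / (m\<^sup>2 + 1)"
    using False y by (simp add: extend_S3_def dist_to_S3_pole m_def del: mem_sphere_0)
  also have "\<dots> \<le> (2 + 2 * B\<^sup>2) * (4 / (n\<^sup>2 + 1))"
    using le pos by (simp add: field_simps)
  also have "4 / (n\<^sup>2 + 1) = (dist y pole)\<^sup>2"
    using dist_to_S3_pole[of "from_S3 y"] to_from_S3[OF y False] by (simp add: n_def)
  also have "(2 + 2 * B\<^sup>2) * (dist y pole)\<^sup>2 = (sqrt (2 + 2 * B\<^sup>2) * dist y pole)\<^sup>2"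
    by (simp add: power_mult_distrib)
  finally show ?thesis
    by (rule power2_le_imp_le) auto
qed (simp add: extend_S3_def)

lemma bij_betw_extend_S3:
  assumes "bij g"
  shows "bij_betw (extend_S3 g) S3 S3"
proof (rule bij_betw_byWitness[where f' = "extend_S3 (inv g)"])
  have gi: "inv g (g x) = x" "g (inv g x) = x" for x
    using assms by (simp_all add: bij_is_inj bij_is_surj surj_f_inv_f)
  show "\<forall>y\<in>S3. extend_S3 (inv g) (extend_S3 g y) = y" "\<forall>y\<in>S3. extend_S3 g (extend_S3 (inv g) y) = y"
    using to_S3_in_S3 by (auto simp: extend_S3_def gi to_from_S3 simp del: mem_sphere_0)
  show "extend_S3 g ` S3 \<subseteq> S3" "extend_S3 (inv g) ` S3 \<subseteq> S3"
    using extend_S3_in_S3 by blast+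
qed

text \<open>
  The extensions of the maps \<open>G t\<close> are homeomorphisms because they are continuous bijections of
  the sphere, a compact Hausdorff space; the bound on the norms gives the continuity at the pole.
\<close>

lemma ambient_isotopic_straight_line:
  fixes g :: "space \<Rightarrow> space"
  defines "G \<equiv> \<lambda>t x. (1 - t) *\<^sub>R x + t *\<^sub>R g x"
  assumes cont: "continuous_on UNIV g"
    and bij: "\<And>t. t \<in> {0..1} \<Longrightarrow> bij (G t)"
    and growth: "\<And>t x. t \<in> {0..1} \<Longrightarrow> norm x \<le> norm (G t x) + B"
    and B: "B \<ge> 0"
  shows "ambient_isotopic (to_S3 ` K) (to_S3 ` g ` K)"
proof -
  let ?S = "top_of_set S3" let ?P = "homeomorphic_map ?S ?S"
  define H where "H = (\<lambda>(t :: real, y). extend_S3 (G t) y)"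
  have Hin: "H (t, y) \<in> S3" if "y \<in> S3" for t y
    using extend_S3_in_S3[OF that] by (simp add: H_def del: mem_sphere_0)
  have contH: "continuous_on ({0..1} \<times> S3) H"
    unfolding continuous_on_eq_continuous_within
  proof
    fix p :: "real \<times> space \<times> real" assume p: "p \<in> {0..1} \<times> S3"
    obtain t y where ty: "p = (t, y)" "t \<in> {0..1}" "y \<in> S3"
      using p by auto
    show "continuous (at p within {0..1} \<times> S3) H"
    proof (cases "y = pole")
      case False
      let ?U = "{0..1} \<times> (S3 - {pole})"
      have "continuous_on ?U (\<lambda>p. from_S3 (snd p))"
        by (rule continuous_on_compose2[OF continuous_on_from_S3]) (auto intro!: continuous_intros)
      moreover from this have "continuous_on ?U (\<lambda>p. g (from_S3 (snd p)))"
        by (rule continuous_on_compose2[OF cont]) auto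
      ultimately have "continuous_on ?U (\<lambda>p. to_S3 (G (fst p) (from_S3 (snd p))))"
        unfolding G_def
        by (intro continuous_on_compose2[OF continuous_on_to_S3[of UNIV]] continuous_intros) auto
      moreover have "H q = to_S3 (G (fst q) (from_S3 (snd q)))" if "q \<in> ?U" for q
        using that unfolding H_def extend_S3_def
        by (cases q) (simp only: mem_Times_iff fst_conv snd_conv case_prod_conv if_True)
      ultimately have "continuous_on ?U H"
        by (metis (no_types, lifting) continuous_on_eq)
      then have "continuous (at p within ?U) H"
        using ty False by (auto simp: continuous_on_eq_continuous_within)
      \<comment> \<open>Away from the pole, removing the pole does not change the neighbourhoods.\<close>
      moreover have "at p within ?U = at p within {0..1} \<times> S3"
      proof (rule at_within_nhd[where S = "UNIV \<times> (- {pole})"])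
        show "open (UNIV \<times> (- {pole}) :: (real \<times> space \<times> real) set)"
          by (intro open_Times) auto
      qed (use ty False in auto)
      ultimately show ?thesis by simp
    next
      case True
      have Hp: "H p = pole"
        by (simp add: ty True H_def extend_S3_def)
      have le: "dist (H q) (H p) \<le> sqrt (2 + 2 * B\<^sup>2) * dist (snd q) pole" if "q \<in> {0..1} \<times> S3" for q
        using that unfolding Hp by (cases q) (auto simp: H_def intro!: dist_extend_S3_pole growth B)
      have "((\<lambda>q. sqrt (2 + 2 * B\<^sup>2) * dist (snd q) pole) \<longlongrightarrow> sqrt (2 + 2 * B\<^sup>2) * dist (snd p) pole)
              (at p within {0..1} \<times> S3)"
        by (intro tendsto_intros)
      then have lim: "((\<lambda>q. sqrt (2 + 2 * B\<^sup>2) * dist (snd q) pole) \<longlongrightarrow> 0) (at p within {0..1} \<times> S3)"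
        by (simp add: ty True)
      have "((\<lambda>q. dist (H q) (H p)) \<longlongrightarrow> 0) (at p within {0..1} \<times> S3)"
        by (rule tendsto_sandwich[OF _ _ tendsto_const lim])
          (use le in \<open>auto simp: eventually_at_filter\<close>)
      then show ?thesis
        unfolding continuous_within by (subst tendsto_dist_iff)
    qed
  qed
  have homeo: "?P (\<lambda>y. H (t, y))" if t: "t \<in> {0..1}" for t
  proof -
    have b: "bij_betw (\<lambda>y. H (t, y)) S3 S3"
      using bij_betw_extend_S3[OF bij[OF t]] by (simp add: H_def)
    have c: "continuous_map ?S ?S (\<lambda>y. H (t, y))"
      using Hin t
      by (auto simp: continuous_map_in_subtopology intro!: continuous_on_compose2[OF contH] continuous_intros)
    have "closed_map ?S ?S (\<lambda>y. H (t, y))"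
      by (rule continuous_imp_closed_map[OF c])
        (auto simp: compact_space_subtopology Hausdorff_space_subtopology)
    then show ?thesis
      using b c by (intro bijective_closed_imp_homeomorphic_map) (auto simp: bij_betw_def)
  qed
  have "homotopic_with ?P ?S ?S id (extend_S3 g)"
    unfolding homotopic_with_def
  proof (intro exI conjI)
    show "continuous_map (prod_topology (top_of_set {0..1}) ?S) ?S H"
      using contH Hin by (auto simp: continuous_map_in_subtopology prod_topology_subtopology_eu)
    have "H (0, y) = y \<and> H (1, y) = extend_S3 g y" for y
      by (auto simp: H_def G_def extend_S3_def to_from_S3 simp del: mem_sphere_0)
    then show "\<forall>x. H (0, x) = id x" "\<forall>x. H (1, x) = extend_S3 g x"
      by auto
  qed (use homeo in auto)
  moreover have "extend_S3 g ` to_S3 ` K = to_S3 ` g ` K"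
    by (simp add: image_image extend_S3_to_S3)
  ultimately show ?thesis
    unfolding ambient_isotopic_def by blast
qed

text \<open>
  For \<open>0 \<le> t \<le> 1\<close> the equation \<open>x + t D(x) = y\<close> says that \<open>x\<close> is a fixed point of the contraction
  \<open>x \<mapsto> y - t D(x)\<close>, so it has exactly one solution.
\<close>

lemma ambient_isotopic_contraction:
  fixes D :: "space \<Rightarrow> space"
  assumes lip: "\<And>x y. norm (D x - D y) \<le> c * norm (x - y)" and c: "0 \<le> c" "c < 1"
    and bound: "\<And>x. norm (D x) \<le> B"
  shows "ambient_isotopic (to_S3 ` K) (to_S3 ` (\<lambda>x. x + D x) ` K)"
proof (rule ambient_isotopic_straight_line)
  have eq: "(1 - t) *\<^sub>R x + t *\<^sub>R (x + D x) = x + t *\<^sub>R D x" for t x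
    by (simp add: algebra_simps)
  show B: "B \<ge> 0"
    using bound[of 0] norm_ge_zero order_trans by blast
  have "c-lipschitz_on UNIV D"
    using lip c by (intro lipschitz_onI) (auto simp: dist_norm)
  then show "continuous_on UNIV (\<lambda>x. x + D x)"
    by (intro continuous_intros lipschitz_on_continuous_on)
  show "bij (\<lambda>x. (1 - t) *\<^sub>R x + t *\<^sub>R (x + D x))" if t: "t \<in> {0..1}" for t
    unfolding eq bij_iff
  proof
    fix y
    have "dist (y - t *\<^sub>R D u) (y - t *\<^sub>R D v) \<le> c * dist u v" for u v
    proof -
      have "dist (y - t *\<^sub>R D u) (y - t *\<^sub>R D v) = t * norm (D u - D v)"
        using t by (simp add: dist_norm flip: scaleR_diff_right)
          (simp add: norm_minus_commute)
      also have "\<dots> \<le> 1 * norm (D u - D v)"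
        using t by (intro mult_right_mono) auto
      finally show ?thesis
        using lip[of u v] by (simp add: dist_norm)
    qed
    then have "\<exists>!x. y - t *\<^sub>R D x = x"
      using c by (intro banach_fix_type) auto
    moreover have "y - t *\<^sub>R D x = x \<longleftrightarrow> x + t *\<^sub>R D x = y" for x
      by (auto simp: algebra_simps)
    ultimately show "\<exists>!x. x + t *\<^sub>R D x = y"
      by simp
  qed
  show "norm x \<le> norm ((1 - t) *\<^sub>R x + t *\<^sub>R (x + D x)) + B" if t: "t \<in> {0..1}" for t x
  proof -
    have "t * norm (D x) \<le> 1 * B"
      using t bound[of x] B by (intro mult_mono) auto
    then show ?thesis
      unfolding eq using norm_diff_ineq[of x "t *\<^sub>R D x"] t by simp
  qed
qed


section \<open>The rotation\<close>

text \<open>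
  The factor \<open>\<surd>2\<close> makes the rotated centers and vertices into the centers of the cells of a unit
  grid; the translation by \<open>1/2\<close> and by \<open>d\<close>, which will be a half-integer, puts the cell corners
  at integer points and the whole diagram into the first quadrant. Heights are unchanged.
\<close>

definition turn :: "real \<Rightarrow> space \<Rightarrow> space"
  where "turn d p = ((fst (fst p) - snd (fst p) + d, fst (fst p) + snd (fst p) + 1/2), snd p)"

lemma ambient_isotopic_turn: "ambient_isotopic (to_S3 ` K) (to_S3 ` turn d ` K)"
proof (rule ambient_isotopic_straight_line)
  have eq: "(1 - t) *\<^sub>R p + t *\<^sub>R turn d p =
      ((fst (fst p) - t * snd (fst p) + t * d, snd (fst p) + t * fst (fst p) + t / 2), snd p)" for t p
    by (cases p) (auto simp: turn_def algebra_simps)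
  show "continuous_on UNIV (turn d)"
    unfolding turn_def by (intro continuous_intros)
  show "bij (\<lambda>p. (1 - t) *\<^sub>R p + t *\<^sub>R turn d p)" for t
    unfolding eq
  proof (rule bijI)
    let ?A = "\<lambda>p :: space. ((fst (fst p) - t * snd (fst p) + t * d, snd (fst p) + t * fst (fst p) + t / 2), snd p)"
    have pos: "1 + t\<^sup>2 > 0"
      by (smt (verit) zero_le_power2)
    show "inj ?A"
    proof (rule injI, clarsimp)
      fix x y x' y' :: real
      assume 1: "x - t * y = x' - t * y'" and 2: "y + t * x = y' + t * x'"
      have "(1 + t\<^sup>2) * (x - x') = (x - t * y - (x' - t * y')) + t * (y + t * x - (y' + t * x'))"
        by (simp add: power2_eq_square algebra_simps)
      then have "x = x'"
        using 1 2 pos by simp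
      then show "x = x' \<and> y = y'"
        using 2 by simp
    qed
    show "surj ?A"
    proof (rule surjI)
      fix q :: space
      obtain u v z where q: "q = ((u + t * d, v + t / 2), z)"
        by (metis diff_add_cancel surj_pair)
      define f where "f = (\<lambda>q :: space. let u = fst (fst q) - t * d; v = snd (fst q) - t / 2
        in (((u + t * v) / (1 + t\<^sup>2), (v - t * u) / (1 + t\<^sup>2)), snd q))"
      have "(u + t * v) / (1 + t\<^sup>2) - t * ((v - t * u) / (1 + t\<^sup>2)) = ((1 + t\<^sup>2) * u) / (1 + t\<^sup>2)"
        "(v - t * u) / (1 + t\<^sup>2) + t * ((u + t * v) / (1 + t\<^sup>2)) = ((1 + t\<^sup>2) * v) / (1 + t\<^sup>2)"
        unfolding times_divide_eq_right diff_divide_distrib[symmetric] add_divide_distrib[symmetric]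
        by (simp_all add: power2_eq_square algebra_simps)
      then show "?A (f q) = q"
        using pos by (simp add: q f_def)
    qed
  qed
  show "norm p \<le> norm ((1 - t) *\<^sub>R p + t *\<^sub>R turn d p) + norm ((d, 1/2 :: real), 0 :: real)"
    if t: "t \<in> {0..1}" for t p
  proof -
    let ?T = "((d, 1/2), 0) :: space"
    \<comment> \<open>The linear part of the map at time \<open>t\<close>; it multiplies horizontal lengths by \<open>sqrt (1 + t\<^sup>2)\<close>.\<close>
    let ?L = "((fst (fst p) - t * snd (fst p), snd (fst p) + t * fst (fst p)), snd p)"
    have "(norm p)\<^sup>2 \<le> (norm ?L)\<^sup>2"
    proof -
      obtain x y z where p: "p = ((x, y), z)" by (metis surj_pair)
      have "(norm ?L)\<^sup>2 - (norm p)\<^sup>2 = (t * x)\<^sup>2 + (t * y)\<^sup>2"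
        by (simp add: p norm_Pair) (simp add: power2_eq_square algebra_simps)
      then show ?thesis
        by (smt (verit) zero_le_power2)
    qed
    then have "norm p \<le> norm ?L"
      by (rule power2_le_imp_le) simp
    also have "?L = ((1 - t) *\<^sub>R p + t *\<^sub>R turn d p) - t *\<^sub>R ?T"
      unfolding eq by simp
    also have "norm \<dots> \<le> norm ((1 - t) *\<^sub>R p + t *\<^sub>R turn d p) + norm (t *\<^sub>R ?T)"
      by (rule norm_triangle_ineq4)
    also have "norm (t *\<^sub>R ?T) \<le> 1 * norm ?T"
      unfolding norm_scaleR using t by (intro mult_right_mono) auto
    finally show ?thesis by simp
  qed
qed simp

lemma turn_closed_segment: "turn d ` closed_segment p q = closed_segment (turn d p) (turn d q)"
proof -
  have "turn d ((1 - u) *\<^sub>R p + u *\<^sub>R q) = (1 - u) *\<^sub>R turn d p + u *\<^sub>R turn d q" for u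
    by (simp add: turn_def prod_eq_iff field_simps)
  then show ?thesis
    by (simp add: closed_segment_image_interval image_image)
qed


section \<open>Straightening the corner in a cell\<close>

text \<open>All points of space above and below a closed cell.\<close>

definition cell_column :: "cell \<Rightarrow> space set"
  where "cell_column C = {p. \<bar>fst (fst p) - fst (center C)\<bar> \<le> 1/2 \<and> \<bar>snd (fst p) - snd (center C)\<bar> \<le> 1/2}"

text \<open>A pyramid over the cell, of height \<open>1/2\<close> at the center and zero on the boundary.\<close>

definition bump :: "cell \<Rightarrow> space \<Rightarrow> real"
  where "bump C p = max 0 (1/2 - max \<bar>fst (fst p) - fst (center C)\<bar> \<bar>snd (fst p) - snd (center C)\<bar>)"

text \<open>
  With \<open>w = edge_offset a + edge_offset b\<close>, the center of the cell moves to the midpoint of the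
  segment between the ends \<open>a\<close> and \<open>b\<close>, and the ends stay fixed. For opposite sides \<open>w = 0\<close>.
\<close>

definition push :: "cell \<Rightarrow> plane \<Rightarrow> space \<Rightarrow> space"
  where "push C w p = p + bump C p *\<^sub>R (w, 0)"

definition leg :: "cell \<Rightarrow> side \<Rightarrow> space set"
  where "leg C s = closed_segment (center C, 0) (edge_endpoint C s, 0)"

lemma bump_lipschitz: "\<bar>bump C p - bump C q\<bar> \<le> norm (p - q)"
proof -
  have "norm (fst (fst (p - q))) \<le> norm (p - q)" "norm (snd (fst (p - q))) \<le> norm (p - q)"
    using norm_fst_le norm_snd_le order_trans by (metis (no_types) prod.collapse)+
  then show ?thesis
    unfolding bump_def by (simp add: max_def abs_if split: if_splits)
qed

lemma ambient_isotopic_push: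
  assumes "norm w < 1"
  shows "ambient_isotopic (to_S3 ` K) (to_S3 ` push C w ` K)"
  unfolding push_def
proof (rule ambient_isotopic_contraction[OF _ norm_ge_zero assms])
  fix p q
  have "norm (bump C p *\<^sub>R (w, 0 :: real) - bump C q *\<^sub>R (w, 0)) = \<bar>bump C p - bump C q\<bar> * norm w"
    by (simp add: norm_Pair flip: scaleR_diff_left)
  also have "\<dots> \<le> norm (p - q) * norm w"
    by (intro mult_right_mono bump_lipschitz norm_ge_zero)
  finally show "norm (bump C p *\<^sub>R (w, 0 :: real) - bump C q *\<^sub>R (w, 0)) \<le> norm w * norm (p - q)"
    by (simp add: mult.commute)
next
  fix p
  have "\<bar>bump C p\<bar> \<le> 1"
    by (simp add: bump_def)
  then show "norm (bump C p *\<^sub>R (w, 0 :: real)) \<le> norm w"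
    by (simp add: norm_Pair mult_left_le_one_le)
qed

lemma push_off_column:
  assumes "p \<in> cell_column C'" "C' \<noteq> C"
  shows "push C w p = p"
proof -
  obtain i j i' j' where C: "C = (i, j)" "C' = (i', j')" by (meson surj_pair)
  have "i \<noteq> i' \<or> j \<noteq> j'" using assms(2) C by auto
  then have "\<bar>real_of_int i - real_of_int i'\<bar> \<ge> 1 \<or> \<bar>real_of_int j - real_of_int j'\<bar> \<ge> 1"
    by linarith
  moreover have "\<bar>fst (fst p) - (real_of_int i' + 1/2)\<bar> \<le> 1/2" "\<bar>snd (fst p) - (real_of_int j' + 1/2)\<bar> \<le> 1/2"
    using assms(1) by (simp_all add: C cell_column_def)
  ultimately have "1/2 \<le> \<bar>fst (fst p) - (real_of_int i + 1/2)\<bar> \<or> 1/2 \<le> \<bar>snd (fst p) - (real_of_int j + 1/2)\<bar>"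
    by linarith
  then have "bump C p = 0"
    by (auto simp: C bump_def max_def)
  then show ?thesis by (simp add: push_def flip: zero_prod_def)
qed

lemma convex_column: "convex (cell_column C)"
proof -
  obtain x y where c: "center C = (x, y)" by (meson surj_pair)
  have "cell_column C = ({x - 1/2..x + 1/2} \<times> {y - 1/2..y + 1/2}) \<times> UNIV"
    by (auto simp: cell_column_def c abs_if split: if_splits)
  then show ?thesis
    by (simp add: convex_Times)
qed

lemma abs_edge_offset_le: "\<bar>fst (edge_offset s)\<bar> \<le> 1/2" "\<bar>snd (edge_offset s)\<bar> \<le> 1/2"
  by (cases s; simp)+

lemma midpoint_edge_endpoints:
  "midpoint (edge_endpoint C a) (edge_endpoint C b) = center C + (1/2) *\<^sub>R (edge_offset a + edge_offset b)"
  by (simp add: edge_endpoint_def midpoint_def algebra_simps flip: scaleR_add_left)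

lemma leg_subset_column: "leg C s \<subseteq> cell_column C"
  unfolding leg_def
  by (rule closed_segment_subset[OF _ _ convex_column]; cases s)
    (auto simp: cell_column_def edge_endpoint_def)

lemma edge_strand_subset_column: "edge_strand C st \<subseteq> cell_column C"
proof -
  obtain a b h where st: "st = (a, b, h)" by (metis surj_pair)
  have "(edge_endpoint C a, 0) \<in> cell_column C" "(edge_endpoint C b, 0) \<in> cell_column C"
    "(midpoint (edge_endpoint C a) (edge_endpoint C b), h) \<in> cell_column C"
    using abs_edge_offset_le[of a] abs_edge_offset_le[of b]
    unfolding cell_column_def midpoint_edge_endpoints by (auto simp: edge_endpoint_def)
  then show ?thesis
    by (simp add: st Let_def closed_segment_subset convex_column)
qed

text \<open>Along a leg the pyramid is affine, so the image of the leg is again a segment.\<close>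

lemma push_leg:
  "push C (edge_offset a + edge_offset b) ` leg C a =
    closed_segment (midpoint (edge_endpoint C a) (edge_endpoint C b), 0) (edge_endpoint C a, 0)"
proof -
  have "push C (edge_offset a + edge_offset b) ((1 - u) *\<^sub>R (center C, 0) + u *\<^sub>R (edge_endpoint C a, 0)) =
      (1 - u) *\<^sub>R (midpoint (edge_endpoint C a) (edge_endpoint C b), 0) + u *\<^sub>R (edge_endpoint C a, 0)"
    if u: "u \<in> {0..1}" for u
  proof -
    have p: "(1 - u) *\<^sub>R (center C, 0::real) + u *\<^sub>R (edge_endpoint C a, 0) = (center C + u *\<^sub>R edge_offset a, 0)"
      by (simp add: edge_endpoint_def algebra_simps)
    have bump: "bump C (center C + u *\<^sub>R edge_offset a, 0) = (1 - u) / 2"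
      using u by (cases a) (auto simp: bump_def field_simps)
    show ?thesis
      unfolding p push_def midpoint_edge_endpoints bump
      by (simp add: edge_endpoint_def algebra_simps diff_divide_distrib)
  qed
  then show ?thesis
    unfolding leg_def closed_segment_image_interval image_image by (intro image_cong) auto
qed

lemma push_legs:
  "push C (edge_offset a + edge_offset b) ` (leg C a \<union> leg C b) = edge_strand C (a, b, 0)"
  using push_leg[of C a b] push_leg[of C b a]
  by (simp add: image_Un Let_def closed_segment_commute midpoint_sym add.commute)

text \<open>
  The offsets of adjacent sides are orthogonal of length \<open>1/2\<close> and those of opposite sides cancel.
  Since \<open>bump\<close> is 1-Lipschitz, \<open>push\<close> differs from the identity by a contraction.
\<close>

lemma norm_edge_offsets:
  assumes "a \<noteq> b"
  shows "norm (edge_offset a + edge_offset b) < 1"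
  using assms by (cases a; cases b) (auto simp: norm_Pair power2_eq_square)

text \<open>
  The cells are treated one after the other: pushing in one cell fixes everything that lies over
  the other cells. The set \<open>R\<close> collects the rest of the link, including the parts that are already
  straight; over a cell of \<open>V\<close> it can meet the boundary only.
\<close>

lemma straighten_corners:
  assumes "finite V" and "\<And>C. C \<in> V \<Longrightarrow> a C \<noteq> b C" and "R \<subseteq> (\<Union>C\<in>-V. cell_column C)"
  shows "ambient_isotopic (to_S3 ` (R \<union> (\<Union>C\<in>V. leg C (a C) \<union> leg C (b C))))
    (to_S3 ` (R \<union> (\<Union>C\<in>V. edge_strand C (a C, b C, 0))))"
  using assms
proof (induction V arbitrary: R rule: finite_induct)
  case empty
  show ?case
    using ambient_isotopic_push[of 0 R undefined] by (simp add: push_def flip: zero_prod_def)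
next
  case (insert C V)
  let ?legs = "\<Union>C\<in>V. leg C (a C) \<union> leg C (b C)"
  let ?new = "edge_strand C (a C, b C, 0)"
  let ?push = "push C (edge_offset (a C) + edge_offset (b C))"
  have fixed: "?push p = p" if "p \<in> R \<union> ?legs" for p
  proof -
    obtain C' where "p \<in> cell_column C'" "C' \<noteq> C"
    proof (cases "p \<in> R")
      case True
      then obtain C' where "p \<in> cell_column C'" "C' \<notin> insert C V"
        using insert.prems(2) by blast
      then show thesis
        using that by blast
    next
      case False
      then obtain C' s where "C' \<in> V" "p \<in> leg C' s"
        using \<open>p \<in> R \<union> ?legs\<close> by blast
      then show thesis
        using that insert.hyps(2) leg_subset_column by blast
    qed
    then show ?thesis
      by (rule push_off_column)
  qed
  have "?push ` (R \<union> ?legs) = (\<lambda>p. p) ` (R \<union> ?legs)"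
    by (rule image_cong[OF refl]) (rule fixed)
  then have fixed_set: "?push ` (R \<union> ?legs) = R \<union> ?legs"
    unfolding image_ident .
  have split: "R \<union> (\<Union>C\<in>insert C V. leg C (a C) \<union> leg C (b C)) = (R \<union> ?legs) \<union> (leg C (a C) \<union> leg C (b C))"
    by auto
  have eq: "?push ` (R \<union> (\<Union>C\<in>insert C V. leg C (a C) \<union> leg C (b C))) = (R \<union> ?new) \<union> ?legs"
    unfolding split image_Un[of _ "R \<union> ?legs"] fixed_set push_legs by (simp only: Un_ac)
  have "ambient_isotopic (to_S3 ` (R \<union> (\<Union>C\<in>insert C V. leg C (a C) \<union> leg C (b C))))
     (to_S3 ` ((R \<union> ?new) \<union> ?legs))"
    unfolding eq[symmetric] by (intro ambient_isotopic_push norm_edge_offsets insert.prems) simp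
  also have "ambient_isotopic \<dots> (to_S3 ` ((R \<union> ?new) \<union> (\<Union>C\<in>V. edge_strand C (a C, b C, 0))))"
  proof (rule insert.IH)
    show "R \<union> ?new \<subseteq> (\<Union>C\<in>-V. cell_column C)"
    proof (rule Un_least)
      show "?new \<subseteq> (\<Union>C\<in>-V. cell_column C)"
        using insert.hyps(2) by (intro SUP_upper2[of C] edge_strand_subset_column) auto
    qed (use insert.prems(2) in blast)
  qed (use insert.prems in auto)
  finally show ?case
    by (simp only: UN_insert Un_ac)
qed


section \<open>Unfolding a corner mosaic\<close>

fun opposite :: "side \<Rightarrow> side" where
  "opposite Left = Right"
| "opposite Bottom = Top"
| "opposite Right = Left"
| "opposite Top = Bottom"

fun corner_vertex :: "cell \<Rightarrow> side \<Rightarrow> int \<times> int" where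
  "corner_vertex (i, j) Left = (i, j + 1)"
| "corner_vertex (i, j) Bottom = (i, j)"
| "corner_vertex (i, j) Right = (i + 1, j)"
| "corner_vertex (i, j) Top = (i + 1, j + 1)"

text \<open>
  Sides at a vertex are named as they appear after the rotation: \<open>cell_at v s\<close> is the tile that
  lies across the side \<open>s\<close> of the new cell around \<open>v\<close>. It has \<open>v\<close> as its corner \<open>opposite s\<close>.
\<close>

fun cell_at :: "int \<times> int \<Rightarrow> side \<Rightarrow> cell" where
  "cell_at (i, j) Left = (i - 1, j)"
| "cell_at (i, j) Bottom = (i - 1, j - 1)"
| "cell_at (i, j) Right = (i, j - 1)"
| "cell_at (i, j) Top = (i, j)"

definition lattice_point :: "int \<times> int \<Rightarrow> plane"
  where "lattice_point = map_prod of_int of_int"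

definition sides_at :: "mosaic \<Rightarrow> int \<times> int \<Rightarrow> side set"
  where "sides_at M v = {s. cell_at v s \<in> cells M \<and> opposite s \<in> ends (tile_at M (cell_at v s))}"

definition nodes :: "mosaic \<Rightarrow> (int \<times> int) set"
  where "nodes M = {v. sides_at M v \<noteq> {}}"

lemma opposite_opposite [simp]: "opposite (opposite s) = s"
  by (cases s) auto

lemma cell_at_corner_vertex [simp]: "cell_at (corner_vertex c s) (opposite s) = c"
  by (cases c; cases s) auto

lemma corner_vertex_cell_at [simp]: "corner_vertex (cell_at v s) (opposite s) = v"
  by (cases v; cases s) auto

lemma corner_endpoint_lattice_point: "corner_endpoint c s = lattice_point (corner_vertex c s)"
  by (cases c; cases s) (auto simp: corner_endpoint_def lattice_point_def)

lemma inj_lattice_point: "inj lattice_point"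
  by (rule injI) (auto simp: lattice_point_def)

lemma opposite_mem_sides_at:
  assumes "c \<in> cells M" "s \<in> ends (tile_at M c)"
  shows "opposite s \<in> sides_at M (corner_vertex c s)"
  using assms by (simp add: sides_at_def)

lemma nodes_eq: "nodes M = (\<Union>c\<in>cells M. corner_vertex c ` ends (tile_at M c))"
proof (intro set_eqI iffI)
  fix v assume "v \<in> nodes M"
  then obtain s where s: "cell_at v s \<in> cells M" "opposite s \<in> ends (tile_at M (cell_at v s))"
    by (auto simp: nodes_def sides_at_def)
  then have "corner_vertex (cell_at v s) (opposite s) \<in> (\<Union>c\<in>cells M. corner_vertex c ` ends (tile_at M c))"
    by blast
  then show "v \<in> (\<Union>c\<in>cells M. corner_vertex c ` ends (tile_at M c))"
    by simp
next
  fix v assume "v \<in> (\<Union>c\<in>cells M. corner_vertex c ` ends (tile_at M c))"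
  then show "v \<in> nodes M"
    using opposite_mem_sides_at unfolding nodes_def by blast
qed

lemma connection_points_eq: "connection_points M = lattice_point ` nodes M"
  unfolding connection_points_def nodes_eq image_UN
  by (simp add: corner_endpoint_lattice_point image_image)

lemma finite_cells: "finite (cells M)"
  by (simp add: cells_def)

lemma finite_nodes: "finite (nodes M)"
proof -
  have "finite (ends t)" for t
    by (cases t) (auto simp: ends_def)
  then show ?thesis
    unfolding nodes_eq using finite_cells by blast
qed

lemma nodes_in_grid:
  assumes "(i, j) \<in> nodes M"
  shows "0 \<le> i \<and> i \<le> int (width M) \<and> 0 \<le> j \<and> j \<le> int (height M)"
proof -
  obtain i' j' s where "(i', j') \<in> cells M" "(i, j) = corner_vertex (i', j') s"
    using assms unfolding nodes_eq by auto
  then show ?thesis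
    by (cases s) (auto simp: cells_def)
qed

text \<open>
  A tile has \<open>v\<close> as at most one of its corners, so the two curves that end at \<open>v\<close> lie on different
  tiles and reach the new cell around \<open>v\<close> through different sides.
\<close>

lemma card_sides_at:
  assumes "corner_mosaic M" "v \<in> nodes M"
  shows "card (sides_at M v) = 2"
proof -
  let ?E = "{(c, s). c \<in> cells M \<and> s \<in> ends (tile_at M c) \<and> corner_endpoint c s = lattice_point v}"
  have "bij_betw (\<lambda>s. (cell_at v s, opposite s)) (sides_at M v) ?E"
  proof (rule bij_betw_byWitness[where f' = "\<lambda>(c, s). opposite s"])
    show "(\<lambda>s. (cell_at v s, opposite s)) ` sides_at M v \<subseteq> ?E"
      by (auto simp: sides_at_def corner_endpoint_lattice_point)
    have "opposite s \<in> sides_at M v \<and> cell_at v (opposite s) = c" if "(c, s) \<in> ?E" for c s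
    proof -
      have "v = corner_vertex c s"
        using that by (simp add: corner_endpoint_lattice_point inj_eq[OF inj_lattice_point])
      then show ?thesis
        using that opposite_mem_sides_at by simp
    qed
    then show "(\<lambda>(c, s). opposite s) ` ?E \<subseteq> sides_at M v"
      "\<forall>x\<in>?E. (cell_at v (case x of (c, s) \<Rightarrow> opposite s), opposite (case x of (c, s) \<Rightarrow> opposite s)) = x"
      by fastforce+
  qed simp
  then have "card (sides_at M v) = card ?E"
    by (rule bij_betw_same_card)
  moreover have "lattice_point v \<in> grid_vertices M"
    using assms(2) nodes_in_grid[of "fst v" "snd v" M]
    by (auto simp: grid_vertices_def lattice_point_def map_prod_def case_prod_beta)
  then have "card ?E \<in> {0, 2}"
    using assms(1) by (simp add: corner_mosaic_def)
  moreover have "finite (sides_at M v)"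
  proof -
    have "(UNIV :: side set) = {Left, Bottom, Right, Top}"
      using side.exhaust by auto
    then show ?thesis
      by (metis finite.simps finite_subset subset_UNIV)
  qed
  ultimately show ?thesis
    using assms(2) by (auto simp: nodes_def)
qed

text \<open>
  The edge tile whose only curve joins the two given sides; the choice avoids listing the cases.
\<close>

definition joining_tile :: "side set \<Rightarrow> tile"
  where "joining_tile S = (SOME t. \<exists>a b. a \<noteq> b \<and> S = {a, b} \<and> strands t = {(a, b, 0)})"

lemma strands_joining_tile:
  assumes "card S = 2"
  shows "\<exists>a b. a \<noteq> b \<and> S = {a, b} \<and> strands (joining_tile S) = {(a, b, 0)}"
  unfolding joining_tile_def
proof (rule someI_ex)
  obtain x y where S: "S = {x, y}" "x \<noteq> y"
    using assms by (auto simp: card_2_iff)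
  then have "\<exists>t. strands t = {(x, y, 0)} \<or> strands t = {(y, x, 0)}"
    by (cases x; cases y; simp; metis strands.simps)
  then show "\<exists>t a b. a \<noteq> b \<and> S = {a, b} \<and> strands t = {(a, b, 0)}"
    using S by (metis insert_commute)
qed

lemma ends_joining_tile:
  assumes "card S = 2"
  shows "ends (joining_tile S) = S"
  using strands_joining_tile[OF assms] by (auto simp: ends_def)

text \<open>
  The new cells whose centers are the images, under the rotation, of the center of a tile and of
  a vertex. The coordinate sum has the parity of \<open>height M + 1\<close> for the former and of \<open>height M\<close>
  for the latter, so they never coincide.
\<close>

fun tile_cell :: "mosaic \<Rightarrow> cell \<Rightarrow> cell"
  where "tile_cell M (i, j) = (i - j + int (height M), i + j + 1)"

fun vertex_cell :: "mosaic \<Rightarrow> int \<times> int \<Rightarrow> cell"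
  where "vertex_cell M (i, j) = (i - j + int (height M), i + j)"

definition unfolded :: "mosaic \<Rightarrow> mosaic"
  where "unfolded M =
    \<lparr>width = width M + height M + 1, height = width M + height M + 1,
     tile_at = (\<lambda>C.
       if C \<in> vertex_cell M ` nodes M then joining_tile (sides_at M (inv (vertex_cell M) C))
       else if C \<in> tile_cell M ` cells M then tile_at M (inv (tile_cell M) C)
       else T0)\<rparr>"

lemma inj_tile_cell: "inj (tile_cell M)"
  by (rule injI) auto

lemma inj_vertex_cell: "inj (vertex_cell M)"
  by (rule injI) auto

lemma tile_cell_not_vertex_cell: "tile_cell M c \<notin> vertex_cell M ` A"
proof -
  have "tile_cell M c \<noteq> vertex_cell M v" for v
    by (cases c; cases v; simp) presburger
  then show ?thesis by blast
qed

declare tile_cell.simps [simp del] vertex_cell.simps [simp del]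

lemma tile_at_unfolded_vertex:
  "v \<in> nodes M \<Longrightarrow> tile_at (unfolded M) (vertex_cell M v) = joining_tile (sides_at M v)"
  by (simp add: unfolded_def inj_vertex_cell)

lemma tile_at_unfolded_tile:
  "c \<in> cells M \<Longrightarrow> tile_at (unfolded M) (tile_cell M c) = tile_at M c"
  by (simp add: unfolded_def inj_tile_cell tile_cell_not_vertex_cell)

lemma tile_cell_in_cells: "c \<in> cells M \<Longrightarrow> tile_cell M c \<in> cells (unfolded M)"
  by (cases c) (auto simp: cells_def unfolded_def tile_cell.simps)

lemma vertex_cell_in_cells: "v \<in> nodes M \<Longrightarrow> vertex_cell M v \<in> cells (unfolded M)"
  using nodes_in_grid[of "fst v" "snd v" M] by (cases v) (auto simp: cells_def unfolded_def vertex_cell.simps)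

lemma nonempty_cells_unfolded:
  assumes "corner_mosaic M"
  shows "{C \<in> cells (unfolded M). tile_at (unfolded M) C \<noteq> T0} =
    tile_cell M ` {c \<in> cells M. tile_at M c \<noteq> T0} \<union> vertex_cell M ` nodes M" (is "?L = ?R")
proof
  show "?L \<subseteq> ?R"
  proof
    fix C assume C: "C \<in> ?L"
    then have "C \<in> vertex_cell M ` nodes M \<or> C \<in> tile_cell M ` cells M"
      by (auto simp: unfolded_def split: if_splits)
    then show "C \<in> ?R"
      using C tile_at_unfolded_tile by auto
  qed
  have "joining_tile (sides_at M v) \<noteq> T0" if "v \<in> nodes M" for v
    using strands_joining_tile[OF card_sides_at[OF assms that]] by auto
  then show "?R \<subseteq> ?L"
    by (auto simp: tile_at_unfolded_vertex tile_at_unfolded_tile tile_cell_in_cells vertex_cell_in_cells)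
qed

lemma tile_count_unfolded:
  assumes "corner_mosaic M"
  shows "tile_count (unfolded M) \<le> tile_count M + card (connection_points M)"
proof -
  have "card (connection_points M) = card (nodes M)"
    unfolding connection_points_eq by (intro card_image inj_on_subset[OF inj_lattice_point]) simp
  moreover have "tile_count (unfolded M) \<le> tile_count M + card (nodes M)"
    unfolding tile_count_def nonempty_cells_unfolded[OF assms]
    by (intro order_trans[OF card_Un_le] add_mono card_image_le) (auto simp: finite_cells finite_nodes)
  ultimately show ?thesis by simp
qed

lemma edge_endpoint_vertex_cell:
  "edge_endpoint (vertex_cell M (corner_vertex c s)) (opposite s) = edge_endpoint (tile_cell M c) s"
  by (cases c; cases s) (auto simp: edge_endpoint_def tile_cell.simps vertex_cell.simps)

lemma edge_adjacent_vertex_cell: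
  "edge_adjacent (tile_cell M c) (vertex_cell M (corner_vertex c s))"
  "edge_adjacent (vertex_cell M (corner_vertex c s)) (tile_cell M c)"
  by (cases c; cases s; simp add: tile_cell.simps vertex_cell.simps)+

lemma edge_mosaic_unfolded:
  assumes "corner_mosaic M"
  shows "edge_mosaic (unfolded M)"
  unfolding edge_mosaic_def
proof (intro ballI)
  fix C s
  assume C: "C \<in> cells (unfolded M)" and s: "s \<in> ends (tile_at (unfolded M) C)"
  have ends: "ends (tile_at (unfolded M) (vertex_cell M v)) = sides_at M v" if "v \<in> nodes M" for v
    using that by (simp add: tile_at_unfolded_vertex ends_joining_tile card_sides_at assms)
  have "tile_at (unfolded M) C \<noteq> T0"
    using s by (auto simp: ends_def)
  then have "C \<in> tile_cell M ` {c \<in> cells M. tile_at M c \<noteq> T0} \<union> vertex_cell M ` nodes M"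
    using nonempty_cells_unfolded[OF assms] C by blast
  then show "\<exists>C'\<in>cells (unfolded M). edge_adjacent C C' \<and>
      (\<exists>s'\<in>ends (tile_at (unfolded M) C'). edge_endpoint C s = edge_endpoint C' s')"
  proof
    assume "C \<in> tile_cell M ` {c \<in> cells M. tile_at M c \<noteq> T0}"
    then obtain c where c: "c \<in> cells M" "C = tile_cell M c" by auto
    let ?v = "corner_vertex c s"
    have *: "opposite s \<in> sides_at M ?v"
      using c s by (intro opposite_mem_sides_at) (simp_all add: tile_at_unfolded_tile)
    then have v: "?v \<in> nodes M"
      by (auto simp: nodes_def)
    show ?thesis
      using * ends[OF v] edge_adjacent_vertex_cell(1)[of M c s] edge_endpoint_vertex_cell[of M c s]
      by (intro bexI[OF _ vertex_cell_in_cells[OF v]]) (auto simp: c intro!: bexI[of _ "opposite s"])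
  next
    assume "C \<in> vertex_cell M ` nodes M"
    then obtain v where v: "v \<in> nodes M" "C = vertex_cell M v" by auto
    let ?c = "cell_at v s"
    have c: "?c \<in> cells M" "opposite s \<in> ends (tile_at M ?c)"
      using s by (auto simp: v ends sides_at_def)
    show ?thesis
      using c edge_adjacent_vertex_cell(2)[of M ?c "opposite s"] edge_endpoint_vertex_cell[of M ?c "opposite s"]
      by (intro bexI[OF _ tile_cell_in_cells[OF c(1)]]) (auto simp: v tile_at_unfolded_tile)
  qed
qed


section \<open>The links of the two mosaics\<close>

abbreviation turn_mosaic :: "mosaic \<Rightarrow> space \<Rightarrow> space"
  where "turn_mosaic M \<equiv> turn (real (height M) + 1/2)"

lemma turn_lattice_point: "turn_mosaic M (lattice_point v, z) = (center (vertex_cell M v), z)"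
  by (cases v) (simp add: turn_def lattice_point_def vertex_cell.simps)

lemma turn_center_corner:
  "turn_mosaic M (midpoint (center c) (corner_endpoint c s), z) = (edge_endpoint (tile_cell M c) s, z)"
  by (cases c; cases s)
    (simp_all add: turn_def midpoint_def corner_endpoint_def edge_endpoint_def tile_cell.simps field_simps)

lemma turn_midpoint:
  "turn d (midpoint p q, z) = (midpoint (fst (turn d (p, z))) (fst (turn d (q, z))), z)"
  by (simp add: turn_def midpoint_def field_simps)

text \<open>
  The middle part of a corner strand becomes the edge strand of the new cell, and each of the two
  segments towards a corner becomes half of the curve in the cell around that corner.
\<close>

lemma turn_corner_strand:
  "turn_mosaic M ` corner_strand c (a, b, h) =
    leg (vertex_cell M (corner_vertex c a)) (opposite a) \<union> edge_strand (tile_cell M c) (a, b, h) \<union>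
    leg (vertex_cell M (corner_vertex c b)) (opposite b)"
proof -
  have corner: "turn_mosaic M (corner_endpoint c s, z) = (center (vertex_cell M (corner_vertex c s)), z)" for s z
    by (simp add: corner_endpoint_lattice_point turn_lattice_point)
  show ?thesis
    unfolding corner_strand.simps edge_strand.simps Let_def polyline.simps image_Un image_empty
      turn_closed_segment turn_midpoint[of _ "midpoint _ _" "midpoint _ _"] turn_center_corner corner leg_def
      edge_endpoint_vertex_cell fst_conv
    by (simp add: closed_segment_commute Un_ac)
qed

lemma turn_corner_link:
  "turn_mosaic M ` corner_link M =
    (\<Union>c\<in>cells M. \<Union>st\<in>strands (tile_at M c). edge_strand (tile_cell M c) st) \<union>
    (\<Union>v\<in>nodes M. \<Union>s\<in>sides_at M v. leg (vertex_cell M v) s)"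
proof -
  \<comment> \<open>The leg in the cell around the vertex where the curve at the corner \<open>s\<close> of \<open>c\<close> ends.\<close>
  define l where "l = (\<lambda>c s. leg (vertex_cell M (corner_vertex c s)) (opposite s))"
  have "turn_mosaic M ` corner_strand c st = edge_strand (tile_cell M c) st \<union> (\<Union>(a, b, h)\<in>{st}. l c a \<union> l c b)" for c st
    by (cases st) (auto simp only: turn_corner_strand l_def)
  then have "turn_mosaic M ` corner_link M =
    (\<Union>c\<in>cells M. \<Union>st\<in>strands (tile_at M c). edge_strand (tile_cell M c) st) \<union>
    (\<Union>c\<in>cells M. \<Union>(a, b, h)\<in>strands (tile_at M c). l c a \<union> l c b)"
    unfolding corner_link_def image_UN by auto
  also have "(\<Union>c\<in>cells M. \<Union>(a, b, h)\<in>strands (tile_at M c). l c a \<union> l c b) =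
    (\<Union>c\<in>cells M. \<Union>s\<in>ends (tile_at M c). l c s)"
    unfolding ends_def by auto
  also have "\<dots> = (\<Union>v\<in>nodes M. \<Union>s\<in>sides_at M v. leg (vertex_cell M v) s)"
  proof (intro set_eqI iffI)
    fix p assume "p \<in> (\<Union>c\<in>cells M. \<Union>s\<in>ends (tile_at M c). l c s)"
    then show "p \<in> (\<Union>v\<in>nodes M. \<Union>s\<in>sides_at M v. leg (vertex_cell M v) s)"
      using opposite_mem_sides_at unfolding l_def nodes_def by blast
  next
    fix p assume "p \<in> (\<Union>v\<in>nodes M. \<Union>s\<in>sides_at M v. leg (vertex_cell M v) s)"
    then obtain v s where vs: "s \<in> sides_at M v" "p \<in> leg (vertex_cell M v) s" by blast
    then have "p \<in> l (cell_at v s) (opposite s)"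
      by (simp add: l_def)
    then show "p \<in> (\<Union>c\<in>cells M. \<Union>s\<in>ends (tile_at M c). l c s)"
      using vs(1) unfolding sides_at_def by blast
  qed
  finally show ?thesis .
qed

lemma edge_link_unfolded:
  assumes "corner_mosaic M"
  shows "edge_link (unfolded M) =
    (\<Union>c\<in>cells M. \<Union>st\<in>strands (tile_at M c). edge_strand (tile_cell M c) st) \<union>
    (\<Union>v\<in>nodes M. \<Union>st\<in>strands (joining_tile (sides_at M v)). edge_strand (vertex_cell M v) st)"
proof -
  let ?N = "unfolded M"
  have nonempty: "(\<Union>c\<in>A. \<Union>st\<in>strands (f c). X c st) = (\<Union>c\<in>{c \<in> A. f c \<noteq> T0}. \<Union>st\<in>strands (f c). X c st)"
    for A :: "cell set" and f and X :: "cell \<Rightarrow> strand \<Rightarrow> space set"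
    by fastforce
  have "edge_link ?N = (\<Union>C\<in>{C \<in> cells ?N. tile_at ?N C \<noteq> T0}. \<Union>st\<in>strands (tile_at ?N C). edge_strand C st)"
    unfolding edge_link_def by (rule nonempty)
  also have "\<dots> = (\<Union>c\<in>{c \<in> cells M. tile_at M c \<noteq> T0}. \<Union>st\<in>strands (tile_at M c). edge_strand (tile_cell M c) st) \<union>
    (\<Union>v\<in>nodes M. \<Union>st\<in>strands (joining_tile (sides_at M v)). edge_strand (vertex_cell M v) st)"
    unfolding nonempty_cells_unfolded[OF assms] by (simp add: tile_at_unfolded_tile tile_at_unfolded_vertex)
  also have "(\<Union>c\<in>{c \<in> cells M. tile_at M c \<noteq> T0}. \<Union>st\<in>strands (tile_at M c). edge_strand (tile_cell M c) st) =
     (\<Union>c\<in>cells M. \<Union>st\<in>strands (tile_at M c). edge_strand (tile_cell M c) st)"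
    by (rule nonempty[symmetric])
  finally show ?thesis .
qed

lemma ambient_isotopic_unfolded:
  assumes "corner_mosaic M"
  shows "ambient_isotopic (to_S3 ` corner_link M) (to_S3 ` edge_link (unfolded M))"
proof -
  let ?R = "\<Union>c\<in>cells M. \<Union>st\<in>strands (tile_at M c). edge_strand (tile_cell M c) st"
  let ?V = "vertex_cell M ` nodes M"
  have "\<forall>v\<in>nodes M. \<exists>a b. a \<noteq> b \<and> sides_at M v = {a, b} \<and>
      strands (joining_tile (sides_at M v)) = {(a, b, 0)}"
    using strands_joining_tile card_sides_at[OF assms] by blast
  then obtain a b where neq: "\<And>v. v \<in> nodes M \<Longrightarrow> a v \<noteq> b v"
    and sides: "\<And>v. v \<in> nodes M \<Longrightarrow> sides_at M v = {a v, b v}"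
    and strands: "\<And>v. v \<in> nodes M \<Longrightarrow> strands (joining_tile (sides_at M v)) = {(a v, b v, 0)}"
    by metis
  let ?a = "a \<circ> inv (vertex_cell M)" and ?b = "b \<circ> inv (vertex_cell M)"
  have "ambient_isotopic (to_S3 ` corner_link M) (to_S3 ` turn_mosaic M ` corner_link M)"
    by (rule ambient_isotopic_turn)
  also have "turn_mosaic M ` corner_link M = ?R \<union> (\<Union>C\<in>?V. leg C (?a C) \<union> leg C (?b C))"
    unfolding turn_corner_link by (auto simp: sides inj_vertex_cell)
  also have "ambient_isotopic (to_S3 ` \<dots>) (to_S3 ` (?R \<union> (\<Union>C\<in>?V. edge_strand C (?a C, ?b C, 0))))"
  proof (rule straighten_corners)
    show "?R \<subseteq> (\<Union>C\<in>-?V. cell_column C)"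
    proof
      fix p assume "p \<in> ?R"
      then obtain c st where "p \<in> edge_strand (tile_cell M c) st" by blast
      then have "p \<in> cell_column (tile_cell M c)"
        using edge_strand_subset_column by blast
      moreover have "tile_cell M c \<in> -?V"
        using tile_cell_not_vertex_cell by simp
      ultimately show "p \<in> (\<Union>C\<in>-?V. cell_column C)" by blast
    qed
  qed (auto simp: finite_nodes neq inj_vertex_cell)
  also have "?R \<union> (\<Union>C\<in>?V. edge_strand C (?a C, ?b C, 0)) = edge_link (unfolded M)"
    unfolding edge_link_unfolded[OF assms] by (simp add: strands inj_vertex_cell del: edge_strand.simps)
  finally show ?thesis .
qed

lemma edge_tile_number_le:
  assumes "M \<in> corner_mosaics L"
  shows "edge_tile_number L \<le> enat (tile_count M) + enat (card (connection_points M))"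
proof -
  have M: "corner_mosaic M" "ambient_isotopic (to_S3 ` corner_link M) L"
    using assms by (auto simp: corner_mosaics_def)
  have "to_S3 ` corner_link M \<subseteq> S3"
    using to_S3_in_S3 by blast
  then have "ambient_isotopic (to_S3 ` edge_link (unfolded M)) L"
    using ambient_isotopic_trans[OF ambient_isotopic_sym[OF ambient_isotopic_unfolded[OF M(1)]] M(2)] by blast
  then have "unfolded M \<in> edge_mosaics L"
    using edge_mosaic_unfolded[OF M(1)] by (simp add: edge_mosaics_def)
  then have "edge_tile_number L \<le> enat (tile_count (unfolded M))"
    unfolding edge_tile_number_def by (rule INF_lower)
  also have "\<dots> \<le> enat (tile_count M + card (connection_points M))"
    using tile_count_unfolded[OF M(1)] by simp
  finally show ?thesis by simp
qed

theorem theorem2: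
  fixes L :: "(space \<times> real) set"
  assumes "tame_link L"
  shows "corner_tile_number L + connpts L \<ge> edge_tile_number L"
proof (cases "minimal_corner_mosaics L = {}")
  case True
  \<comment> \<open>Then \<open>connpts L\<close> is the infimum of the empty set.\<close>
  then show ?thesis
    by (simp add: connpts_def top_enat_def)
next
  case False
  then obtain M' where "M' \<in> minimal_corner_mosaics L" by blast
  then have "connpts L \<in> (\<lambda>M. enat (card (connection_points M))) ` minimal_corner_mosaics L"
    unfolding connpts_def by (intro wellorder_InfI[of "enat (card (connection_points M'))"] imageI)
  then obtain M where M: "M \<in> minimal_corner_mosaics L" "connpts L = enat (card (connection_points M))"
    by auto
  then have "M \<in> corner_mosaics L" "corner_tile_number L = enat (tile_count M)"
    by (auto simp: minimal_corner_mosaics_def)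
  then show ?thesis
    using edge_tile_number_le M(2) by metis
qed

end
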